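(* Let $\lambda>0$, $r>0$ and $n\ge 1$, and let $P^c_n$ be the probability that the exponential random geometric graph $G_n(\lambda,r)$ is connected. Then $$P^c_n=\prod_{i=1}^{n-1}\left(1-e^{-i\lambda r}\right).$$
   Context: $G_n(\lambda,r)$ is the random graph with vertex set $\{X_1,\dots,X_n\}$, where $X_1,\dots,X_n$ are i.i.d. exponential random variables with mean $\lambda^{-1}$, and with an edge between $X_i$ and $X_j$ ($i\neq j$) if and only if $|X_i-X_j|\le r$. An empty product equals $1$. *)

theory Defs
  imports "HOL-Probability.Probability" "Graph_Theory.Digraph_Component"
begin

text \<open>
  Undirected graphs are symmetric digraphs, as in the Graph_Theory library. The vertices are the
  labels 1, ..., n, where label i stands for the point at position x i; coinciding positions
  therefore still give distinct vertices (joined by an edge), and there are no loops.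
\<close>

definition geometric_graph :: "nat \<Rightarrow> real \<Rightarrow> (nat \<Rightarrow> real) \<Rightarrow> nat pair_pre_digraph" where
  "geometric_graph n r x =
     \<lparr> pverts = {1..n},
       parcs = {(i, j). i \<in> {1..n} \<and> j \<in> {1..n} \<and> i \<noteq> j \<and> \<bar>x i - x j\<bar> \<le> r} \<rparr>"

lemma graph_geometric_graph: "graph (with_proj (geometric_graph n r x))"
proof -
  have "finite (parcs (geometric_graph n r x))"
    by (rule finite_subset[of _ "{1..n} \<times> {1..n}"]) (auto simp: geometric_graph_def)
  then show ?thesis
    by unfold_locales
      (auto simp: geometric_graph_def arc_to_ends_def symmetric_def sym_def abs_minus_commute)
qed

end

theory Submission
  imports Defs
begin

text \<open>
  The graph is connected iff, on the line, no point other than a rightmost one is followed by a gap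
  longer than \<open>r\<close>. Writing the event this way (\<open>small_gaps\<close>) makes it translation invariant and
  makes it behave well when a new leftmost point is added: if the old points all lie strictly to the
  right of the new point \<open>t\<close>, the enlarged set has small gaps iff the old one has and some old point
  lies in \<open>(t, t + r]\<close>.

  The probability of small gaps among \<open>m + 1\<close> points follows from the lack of memory. Given that
  \<open>m\<close> independent exponentials all exceed \<open>s\<close>, which happens with probability
  \<open>exp (- m l s)\<close>, their translates by \<open>- s\<close> are again independent exponentials, so
  translation-invariant events are independent of the event "all exceed \<open>s\<close>"
  (\<open>measure_expos_shift\<close>). Condition on point \<open>i\<close> being at \<open>t\<close> and strictly to the left of the
  others. If \<open>p\<close> is the probability of small gaps among the others, then the whole configuration
  has small gaps with probability
  \<open>p (exp (- m l t) - exp (- m l (t + r))) = p (1 - exp (- m l r)) exp (- m l t)\<close>,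
  and integrating \<open>exp (- m l t)\<close> against the density of point \<open>i\<close> gives the factor
  \<open>1 / (m + 1)\<close> (\<open>measure_expos_min_small_gaps\<close>). Summing over the \<open>m + 1\<close> candidates for the
  minimum multiplies the probability by \<open>1 - exp (- m l r)\<close>, and the product formula follows by
  induction.

  Ties need no separate treatment: the same integral with the sure event shows that each
  point is the strict minimum with probability \<open>1 / (m + 1)\<close>. These disjoint events therefore
  have total probability one.
\<close>

section \<open>Connectedness as a condition on gaps\<close>

text \<open>
  Phrased without sorting the points, so that coinciding points are harmless; the condition is
  vacuous at the rightmost position.
\<close>

definition small_gaps :: "'i set \<Rightarrow> real \<Rightarrow> ('i \<Rightarrow> real) \<Rightarrow> bool" where
  "small_gaps I r x \<longleftrightarrow>
     (\<forall>i\<in>I. (\<exists>j\<in>I. x i < x j) \<longrightarrow> (\<exists>j\<in>I. x i < x j \<and> x j \<le> x i + r))"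

text \<open>
  If the gap after \<open>x i\<close> is longer than \<open>r\<close>, no path from \<open>i\<close> can leave the set of points to the left of
  or at \<open>x i\<close>. Conversely, small gaps allow each vertex to step strictly to the right until it reaches
  the maximal position, and vertices at the maximal position are adjacent.
\<close>

lemma connected_geometric_graph_iff:
  assumes "n \<ge> 1" "r \<ge> 0"
  shows "Digraph_Component.connected (with_proj (geometric_graph n r x)) \<longleftrightarrow> small_gaps {1..n} r x"
proof -
  let ?I = "{1..n}"
  define E where "E = {(i, j). i \<in> ?I \<and> j \<in> ?I \<and> i \<noteq> j \<and> \<bar>x i - x j\<bar> \<le> r}"
  have symE: "sym E"
    by (auto simp: E_def sym_def abs_minus_commute)
  then have "E\<^sup>s = E"
    by (auto simp: symcl_def sym_def)
  moreover have reach: "(u, v) \<in> rtrancl_on ?I E \<longleftrightarrow> (u, v) \<in> E\<^sup>*" if "u \<in> ?I" for u v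
  proof
    assume "(u, v) \<in> E\<^sup>*"
    then show "(u, v) \<in> rtrancl_on ?I E"
    proof (induction rule: rtrancl_induct)
      case base
      show ?case using that by (rule rtrancl_on_refl)
    next
      case (step y z)
      then show ?case by (auto intro: rtrancl_on_into_rtrancl_on simp: E_def)
    qed
  qed (rule rtrancl_on_rtranclI)
  ultimately have conn: "Digraph_Component.connected (with_proj (geometric_graph n r x)) \<longleftrightarrow>
      (\<forall>u\<in>?I. \<forall>v\<in>?I. (u, v) \<in> E\<^sup>*)"
    using assms(1) by (simp add: connected_conv geometric_graph_def E_def)
  show ?thesis unfolding conn
  proof
    assume all: "\<forall>u\<in>?I. \<forall>v\<in>?I. (u, v) \<in> E\<^sup>*"
    show "small_gaps ?I r x" unfolding small_gaps_def
    proof (intro ballI impI; rule ccontr)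
      fix i assume i: "i \<in> ?I" and ex: "\<exists>j\<in>?I. x i < x j"
        and gap: "\<not> (\<exists>j\<in>?I. x i < x j \<and> x j \<le> x i + r)"
      \<comment> \<open>The points at or to the left of \<open>x i\<close> are closed under adjacency.\<close>
      have stuck: "x k \<le> x i" if "(i, k) \<in> E\<^sup>*" for k
        using that
      proof (induction rule: rtrancl_induct)
        case (step k l)
        then have "l \<in> ?I" "x l \<le> x i + r" by (auto simp: E_def)
        with gap show ?case by force
      qed simp
      from ex obtain j where "j \<in> ?I" "x i < x j" by blast
      with all i stuck show False by force
    qed
  next
    assume gaps: "small_gaps ?I r x"
    define m where "m = Max (x ` ?I)"
    have m: "x i \<le> m" if "i \<in> ?I" for i
      using that by (auto simp: m_def)
    have "m \<in> x ` ?I"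
      unfolding m_def using assms(1) by (intro Max_in) auto
    then obtain t where t: "t \<in> ?I" "x t = m" by blast
    have to_top: "(i, t) \<in> E\<^sup>*" if "i \<in> ?I" for i
      using that
    proof (induction "card {j \<in> ?I. x i < x j}" arbitrary: i rule: less_induct)
      case less
      show ?case
      proof (cases "x i = m")
        case True
        then show ?thesis
          using t less.prems assms(2) by (cases "i = t") (auto simp: E_def)
      next
        case False
        then have "\<exists>j\<in>?I. x i < x j"
          using t m[OF less.prems] by force
        then obtain j where j: "j \<in> ?I" "x i < x j" "x j \<le> x i + r"
          using gaps less.prems unfolding small_gaps_def by blast
        then have "card {k \<in> ?I. x j < x k} < card {k \<in> ?I. x i < x k}"
          by (intro psubset_card_mono) auto
        then have "(j, t) \<in> E\<^sup>*"
          using less.hyps j(1) by blast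
        moreover have "(i, j) \<in> E"
          using j less.prems by (auto simp: E_def)
        ultimately show ?thesis by (rule converse_rtrancl_into_rtrancl[rotated])
      qed
    qed
    have "(t, i) \<in> E\<^sup>*" if "i \<in> ?I" for i
      using to_top[OF that] sym_rtrancl[OF symE] by (auto simp: sym_def)
    with to_top show "\<forall>u\<in>?I. \<forall>v\<in>?I. (u, v) \<in> E\<^sup>*"
      by (meson rtrancl_trans)
  qed
qed

lemma small_gaps_cong:
  assumes "\<And>i. i \<in> I \<Longrightarrow> x i = y i"
  shows "small_gaps I r x \<longleftrightarrow> small_gaps I r y"
  using assms by (simp add: small_gaps_def cong: ball_cong bex_cong)

lemma small_gaps_translate: "small_gaps I r (\<lambda>i\<in>I. x i + s) \<longleftrightarrow> small_gaps I r x"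
  by (simp add: small_gaps_def algebra_simps cong: ball_cong bex_cong)

text \<open>
  The new leftmost point is never the right neighbour of another point, so it only adds the condition
  on its own gap; \<open>I\<close> must be nonempty for that gap to exist.
\<close>

lemma small_gaps_insert_min:
  assumes "I \<noteq> {}" and min: "\<And>j. j \<in> I \<Longrightarrow> x i < x j"
  shows "small_gaps (insert i I) r x \<longleftrightarrow> small_gaps I r x \<and> (\<exists>j\<in>I. x j \<le> x i + r)"
proof -
  have up: "(\<exists>j\<in>insert i I. x k < x j \<and> P j) \<longleftrightarrow> (\<exists>j\<in>I. x k < x j \<and> P j)" if "k \<in> I" for k P
    using min[OF that] by simp
  have up': "(\<exists>j\<in>insert i I. x k < x j) \<longleftrightarrow> (\<exists>j\<in>I. x k < x j)" if "k \<in> I" for k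
    using min[OF that] by simp
  have bot: "(\<exists>j\<in>insert i I. x i < x j \<and> P j) \<longleftrightarrow> (\<exists>j\<in>I. P j)" for P
    using min by auto
  have split: "(\<forall>k\<in>insert i I. P k) \<longleftrightarrow> P i \<and> (\<forall>k\<in>I. P k)" for P
    by blast
  have bot': "\<exists>j\<in>insert i I. x i < x j"
    using min assms(1) by auto
  have "small_gaps (insert i I) r x \<longleftrightarrow> (\<exists>j\<in>I. x j \<le> x i + r) \<and>
      (\<forall>k\<in>I. (\<exists>j\<in>insert i I. x k < x j) \<longrightarrow> (\<exists>j\<in>insert i I. x k < x j \<and> x j \<le> x k + r))"
    unfolding small_gaps_def split by (simp only: bot bot' simp_thms)
  also have "\<dots> \<longleftrightarrow> (\<exists>j\<in>I. x j \<le> x i + r) \<and> small_gaps I r x"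
    unfolding small_gaps_def by (simp only: up up' cong: ball_cong)
  finally show ?thesis by blast
qed

section \<open>Independent exponential variables and lack of memory\<close>

abbreviation expo :: "real \<Rightarrow> real measure" where
  "expo l \<equiv> density lborel (exponential_density l)"

abbreviation expos :: "real \<Rightarrow> 'i set \<Rightarrow> ('i \<Rightarrow> real) measure" where
  "expos l I \<equiv> (\<Pi>\<^sub>M i\<in>I. expo l)"

lemma prob_space_expo: "l > 0 \<Longrightarrow> prob_space (expo l)"
  by (rule prob_space_exponential_density)

lemma product_sigma_finite_expo: "l > 0 \<Longrightarrow> product_sigma_finite (\<lambda>_. expo l)"
  by (simp add: product_sigma_finite_def prob_space_expo prob_space_imp_sigma_finite)

lemma prob_space_expos: "l > 0 \<Longrightarrow> prob_space (expos l I)"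
  by (intro prob_space_PiM prob_space_expo)

lemma sets_expos [measurable_cong]: "sets (expos l I) = sets (\<Pi>\<^sub>M i\<in>I. borel)"
  by (intro sets_PiM_cong) simp_all

lemma measurable_expos_iff: "measurable (expos l I) N = measurable (\<Pi>\<^sub>M i\<in>I. borel) N"
  by (intro measurable_cong_sets sets_expos refl)

text \<open>
  Lack of memory for a single variable, in integral form: the substitution \<open>y \<mapsto> y + s\<close> multiplies
  the density by \<open>exp (- l * s)\<close>. The integrands differ at the single point \<open>0\<close>, where the indicator of
  the open half line vanishes.
\<close>

lemma nn_integral_expo_shift:
  assumes "l > 0" "s \<ge> 0" and [measurable]: "f \<in> borel_measurable borel"
  shows "(\<integral>\<^sup>+y. f y * indicator {s<..} y \<partial>expo l) = ennreal (exp (- l * s)) * (\<integral>\<^sup>+y. f (y + s) \<partial>expo l)"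
proof -
  have "(\<integral>\<^sup>+y. f y * indicator {s<..} y \<partial>expo l)
      = (\<integral>\<^sup>+y. ennreal (exponential_density l y) * (f y * indicator {s<..} y) \<partial>lborel)"
    by (simp add: nn_integral_density)
  also have "\<dots> = (\<integral>\<^sup>+y. ennreal (exponential_density l (s + 1 * y)) *
      (f (s + 1 * y) * indicator {s<..} (s + 1 * y)) \<partial>lborel)"
    by (subst nn_integral_real_affine[of _ 1 s]) simp_all
  also have "\<dots> = (\<integral>\<^sup>+y. ennreal (exp (- l * s)) * (ennreal (exponential_density l y) * f (y + s)) \<partial>lborel)"
  proof (rule nn_integral_cong_AE, rule AE_mp[OF AE_lborel_singleton[of 0]], rule AE_I2, rule impI)
    fix y :: real assume "y \<noteq> 0"
    show "ennreal (exponential_density l (s + 1 * y)) *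
          (f (s + 1 * y) * indicator {s<..} (s + 1 * y)) =
        ennreal (exp (- l * s)) * (ennreal (exponential_density l y) * f (y + s))"
    proof (cases "y < 0")
      case False
      have "exponential_density l (s + y) = exp (- l * s) * exponential_density l y"
        using False assms(2) by (simp add: exponential_density_def exp_add[symmetric] algebra_simps)
      then have "ennreal (exponential_density l (s + y)) =
          ennreal (exp (- l * s)) * ennreal (exponential_density l y)"
        by (simp add: ennreal_mult'[symmetric])
      then show ?thesis
        using False \<open>y \<noteq> 0\<close> by (simp add: ac_simps)
    qed (simp add: exponential_density_def)
  qed
  also have "\<dots> = ennreal (exp (- l * s)) * (\<integral>\<^sup>+y. f (y + s) \<partial>expo l)"
    by (simp add: nn_integral_cmult nn_integral_density)
  finally show ?thesis .
qed

text \<open>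
  Lack of memory for all coordinates at once, by induction on the index set with Fubini. A general
  integrand \<open>f\<close> is needed because the induction hypothesis is applied to the sections of \<open>f\<close>.
\<close>

lemma nn_integral_expos_shift:
  assumes "l > 0" "s \<ge> 0" "finite I" and "f \<in> borel_measurable (\<Pi>\<^sub>M i\<in>I. borel)"
  shows "(\<integral>\<^sup>+x. f x * (\<Prod>i\<in>I. indicator {s<..} (x i)) \<partial>expos l I) =
    ennreal (exp (- real (card I) * l * s)) * (\<integral>\<^sup>+x. f (\<lambda>i\<in>I. x i + s) \<partial>expos l I)"
  using assms(3,4)
proof (induction I arbitrary: f rule: finite_induct)
  case empty
  interpret product_sigma_finite "\<lambda>_. expo l"
    using assms(1) by (rule product_sigma_finite_expo)
  show ?case by (simp add: PiM_empty nn_integral_count_space_finite restrict_def)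
next
  case (insert i I)
  interpret product_sigma_finite "\<lambda>_. expo l"
    using assms(1) by (rule product_sigma_finite_expo)
  interpret prob_space "expos l I"
    using assms(1) by (rule prob_space_expos)
  note [measurable] = insert.prems
  let ?c = "ennreal (exp (- real (card I) * l * s))"
  \<comment> \<open>Only the coordinates in \<open>I\<close> are shifted; coordinate \<open>i\<close> is shifted in a separate step.\<close>
  define T where "T y x = (\<lambda>j\<in>I. x j + s)(i := y)" for y and x :: "_ \<Rightarrow> real"
  have T_alt: "T y x = (\<lambda>j\<in>insert i I. if j = i then y else x j + s)" for x y
    using insert.hyps by (auto simp: T_def fun_eq_iff)
  have T_meas [measurable]: "(\<lambda>(y, x). T y x) \<in> borel \<Otimes>\<^sub>M expos l I \<rightarrow>\<^sub>M (\<Pi>\<^sub>M i\<in>insert i I. borel)"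
    unfolding T_alt case_prod_beta
  proof (rule measurable_restrict)
    fix j assume "j \<in> insert i I"
    then show "(\<lambda>p. if j = i then fst p else snd p j + s) \<in> borel_measurable (borel \<Otimes>\<^sub>M expos l I)"
      by (cases "j = i") (simp_all)
  qed
  have fT [measurable]: "(\<lambda>(y, x). f (T y x)) \<in> borel_measurable (borel \<Otimes>\<^sub>M expos l I)"
    using measurable_compose[OF T_meas insert.prems] by (simp add: case_prod_beta)
  have "(\<integral>\<^sup>+x. f x * (\<Prod>i\<in>insert i I. indicator {s<..} (x i)) \<partial>expos l (insert i I))
      = (\<integral>\<^sup>+y. (\<integral>\<^sup>+x. f (x(i := y)) * (\<Prod>j\<in>insert i I. indicator {s<..} ((x(i := y)) j)) \<partial>expos l I) \<partial>expo l)"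
    using insert.hyps by (intro product_nn_integral_insert_rev; (unfold measurable_expos_iff)?) (simp_all)
  also have "\<dots> = (\<integral>\<^sup>+y. (\<integral>\<^sup>+x. (f (x(i := y)) * (\<Prod>i\<in>I. indicator {s<..} (x i)))  \<partial>expos l I) * indicator {s<..} y \<partial>expo l)"
  proof (intro nn_integral_cong)
    fix y :: real
    have "(\<Prod>j\<in>I. indicator {s<..} ((x(i := y)) j)) = (\<Prod>j\<in>I. indicator {s<..} (x j) :: ennreal)" for x
      using insert.hyps by (intro prod.cong) auto
    then show "(\<integral>\<^sup>+x. f (x(i := y)) * (\<Prod>j\<in>insert i I. indicator {s<..} ((x(i := y)) j)) \<partial>expos l I) =
        (\<integral>\<^sup>+x. (f (x(i := y)) * (\<Prod>i\<in>I. indicator {s<..} (x i))) \<partial>expos l I) * indicator {s<..} y"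
      using insert.hyps by (cases "s < y") simp_all
  qed
  also have "\<dots> = (\<integral>\<^sup>+y. (?c * (\<integral>\<^sup>+x. f (T y x) \<partial>expos l I)) * indicator {s<..} y \<partial>expo l)"
  proof (intro nn_integral_cong arg_cong[of _ _ "\<lambda>v. v * _"])
    fix y :: real
    have "(\<lambda>x. x(i := y)) \<in> (\<Pi>\<^sub>M i\<in>I. borel) \<rightarrow>\<^sub>M (\<Pi>\<^sub>M i\<in>insert i I. borel)"
      by (rule measurable_fun_upd[where J = I]) simp_all
    then have "(\<lambda>x. f (x(i := y))) \<in> borel_measurable (\<Pi>\<^sub>M i\<in>I. borel)"
      using insert.prems by (rule measurable_compose)
    from insert.IH[OF this]
    show "(\<integral>\<^sup>+x. (f (x(i := y)) * (\<Prod>i\<in>I. indicator {s<..} (x i))) \<partial>expos l I) =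
        ?c * (\<integral>\<^sup>+x. f (T y x) \<partial>expos l I)"
      by (simp only: T_def)
  qed
  also have "\<dots> = ennreal (exp (- l * s)) * (\<integral>\<^sup>+y. ?c * (\<integral>\<^sup>+x. f (T (y + s) x) \<partial>expos l I) \<partial>expo l)"
    using assms(1,2) by (intro nn_integral_expo_shift) measurable
  also have "\<dots> = ennreal (exp (- l * s)) * ?c * (\<integral>\<^sup>+y. (\<integral>\<^sup>+x. f (T (y + s) x) \<partial>expos l I) \<partial>expo l)"
    by (simp add: nn_integral_cmult mult.assoc)
  also have "ennreal (exp (- l * s)) * ?c = ennreal (exp (- real (card (insert i I)) * l * s))"
    using insert.hyps by (simp add: ennreal_mult[symmetric] exp_add[symmetric] algebra_simps)
  also have "(\<integral>\<^sup>+y. (\<integral>\<^sup>+x. f (T (y + s) x) \<partial>expos l I) \<partial>expo l)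
      = (\<integral>\<^sup>+y. (\<integral>\<^sup>+x. f (\<lambda>j\<in>insert i I. (x(i := y)) j + s) \<partial>expos l I) \<partial>expo l)"
    unfolding T_alt by (intro nn_integral_cong arg_cong[of _ _ f]) auto
  also have "\<dots> = (\<integral>\<^sup>+x. f (\<lambda>i\<in>insert i I. x i + s) \<partial>expos l (insert i I))"
    using insert.hyps by (intro product_nn_integral_insert_rev[symmetric]) auto
  finally show ?case .
qed


lemma pred_small_gaps:
  assumes "finite I"
  shows "Measurable.pred (\<Pi>\<^sub>M i\<in>I. borel) (small_gaps I r)"
proof -
  have coord: "(\<lambda>x. x i) \<in> borel_measurable (\<Pi>\<^sub>M i\<in>I. (borel :: real measure))" if "i \<in> I" for i
    using that by (rule measurable_component_singleton)
  have "Measurable.pred (\<Pi>\<^sub>M i\<in>I. borel) (\<lambda>x. x j \<le> x i + r)" if "i \<in> I" "j \<in> I" for i j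
    unfolding pred_def using that
    by (intro borel_measurable_le borel_measurable_add borel_measurable_const coord)
  moreover have "Measurable.pred (\<Pi>\<^sub>M i\<in>I. borel) (\<lambda>x. x i < (x j :: real))" if "i \<in> I" "j \<in> I" for i j
    using that by (intro borel_measurable_pred_less coord)
  ultimately show ?thesis
    unfolding small_gaps_def using assms
    by (intro pred_intros_finite pred_intros_logic)
qed

text \<open>
  The shift applied to the indicator of \<open>Q\<close>, which invariance turns back into the unshifted
  indicator.
\<close>

lemma measure_expos_shift:
  assumes "l > 0" "s \<ge> 0" "finite I"
    and [measurable]: "Measurable.pred (\<Pi>\<^sub>M i\<in>I. borel) Q"
    and inv: "\<And>x. Q (\<lambda>i\<in>I. x i + s) \<longleftrightarrow> Q x"
  shows "measure (expos l I) {x \<in> space (expos l I). (\<forall>j\<in>I. s < x j) \<and> Q x} =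
    exp (- real (card I) * l * s) * measure (expos l I) {x \<in> space (expos l I). Q x}"
proof -
  interpret prob_space "expos l I"
    using assms(1) by (rule prob_space_expos)
  have [measurable]: "{x \<in> space (expos l I). (\<forall>j\<in>I. s < x j) \<and> Q x} \<in> events"
    using assms(3) by measurable
  have [measurable]: "{x \<in> space (expos l I). Q x} \<in> events"
    by measurable
  have meas: "(\<lambda>x. indicator {x. Q x} x :: ennreal) \<in> borel_measurable (\<Pi>\<^sub>M i\<in>I. borel)"
    unfolding indicator_def of_bool_def mem_Collect_eq by measurable
  have "emeasure (expos l I) {x \<in> space (expos l I). (\<forall>j\<in>I. s < x j) \<and> Q x} =
      (\<integral>\<^sup>+x. indicator {x \<in> space (expos l I). (\<forall>j\<in>I. s < x j) \<and> Q x} x \<partial>expos l I)"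
    by simp
  also have "\<dots> = (\<integral>\<^sup>+x. indicator {x. Q x} x * (\<Prod>i\<in>I. indicator {s<..} (x i)) \<partial>expos l I)"
    using assms(3) by (intro nn_integral_cong) (auto simp: indicator_def of_bool_def)
  also have "\<dots> = ennreal (exp (- real (card I) * l * s)) *
      (\<integral>\<^sup>+x. indicator {x. Q x} (\<lambda>i\<in>I. x i + s) \<partial>expos l I)"
    using assms(1-3) meas by (rule nn_integral_expos_shift)
  also have "(\<integral>\<^sup>+x. indicator {x. Q x} (\<lambda>i\<in>I. x i + s) \<partial>expos l I) =
      (\<integral>\<^sup>+x. indicator {x \<in> space (expos l I). Q x} x \<partial>expos l I)"
    by (intro nn_integral_cong) (simp add: indicator_def inv)
  also have "\<dots> = emeasure (expos l I) {x \<in> space (expos l I). Q x}"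
    by simp
  finally show ?thesis
    by (simp add: emeasure_eq_measure ennreal_mult[symmetric])
qed

section \<open>Conditioning on the smallest point\<close>

text \<open>
  Fubini over the coordinate \<open>i\<close>. The value \<open>K / (m + 1)\<close> appears because
  \<open>exp (- m * l * t)\<close> times the density of rate \<open>l\<close> is \<open>1 / (m + 1)\<close> times the density of rate
  \<open>(m + 1) * l\<close>, which has total mass one.
\<close>

lemma measure_expos_min_first:
  assumes "l > 0" "finite I" "i \<notin> I" "K \<ge> 0"
    and [measurable]: "Measurable.pred (\<Pi>\<^sub>M i\<in>insert i I. borel) Q"
    and tail: "\<And>t. t \<ge> 0 \<Longrightarrow>
      measure (expos l I) {x \<in> space (expos l I). (\<forall>j\<in>I. t < x j) \<and> Q (x(i := t))} =
        K * exp (- real (card I) * l * t)"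
  shows "measure (expos l (insert i I))
      {x \<in> space (expos l (insert i I)). (\<forall>j\<in>I. x i < x j) \<and> Q x} = K / (real (card I) + 1)"
proof -
  interpret product_sigma_finite "\<lambda>_. expo l"
    using assms(1) by (rule product_sigma_finite_expo)
  interpret P: prob_space "expos l I"
    using assms(1) by (rule prob_space_expos)
  interpret P': prob_space "expos l (insert i I)"
    using assms(1) by (rule prob_space_expos)
  let ?m = "real (card I)"
  let ?S = "{x \<in> space (expos l (insert i I)). (\<forall>j\<in>I. x i < x j) \<and> Q x}"
  let ?T = "\<lambda>t. {x \<in> space (expos l I). (\<forall>j\<in>I. t < x j) \<and> Q (x(i := t))}"
  have S: "?S \<in> P'.events"
    using assms(2) by measurable
  have ST: "indicator ?S (x(i := t)) = (indicator (?T t) x :: ennreal)" if "x \<in> space (expos l I)" for x t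
    using that assms(3)
    by (auto simp: indicator_def space_PiM PiE_def extensional_def fun_upd_def of_bool_def)
  have T: "?T t \<in> P.events" for t
  proof -
    have "(\<lambda>x. x(i := t)) \<in> expos l I \<rightarrow>\<^sub>M (\<Pi>\<^sub>M i\<in>insert i I. borel)"
      by (rule measurable_fun_upd[where J = I]) simp_all
    then have "Measurable.pred (expos l I) (\<lambda>x. Q (x(i := t)))"
      by measurable
    then show ?thesis
      using assms(2) by measurable
  qed
  have "emeasure (expos l (insert i I)) ?S = (\<integral>\<^sup>+x. indicator ?S x \<partial>expos l (insert i I))"
    using S by simp
  also have "\<dots> = (\<integral>\<^sup>+t. (\<integral>\<^sup>+x. indicator ?S (x(i := t)) \<partial>expos l I) \<partial>expo l)"
    using assms(2,3) S by (intro product_nn_integral_insert_rev) auto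
  also have "\<dots> = (\<integral>\<^sup>+t. emeasure (expos l I) (?T t) \<partial>expo l)"
    using T by (simp add: ST cong: nn_integral_cong)
  also have "\<dots> = (\<integral>\<^sup>+t. ennreal (K * exp (- ?m * l * t)) \<partial>expo l)"
  proof (rule nn_integral_cong_AE)
    have "AE t in expo l. t \<ge> 0"
      by (simp add: AE_density exponential_density_def not_less)
    then show "AE t in expo l. emeasure (expos l I) (?T t) = ennreal (K * exp (- ?m * l * t))"
      by (rule AE_mp) (simp add: tail P.emeasure_eq_measure)
  qed
  also have "\<dots> = (\<integral>\<^sup>+t. ennreal (K / (?m + 1)) * ennreal (exponential_density ((?m + 1) * l) t) \<partial>lborel)"
  proof -
    have "ennreal (exponential_density l t) * ennreal (K * exp (- ?m * l * t)) =
        ennreal (K / (?m + 1)) * ennreal (exponential_density ((?m + 1) * l) t)" for t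
    proof -
      have "exponential_density l t * (K * exp (- ?m * l * t)) =
          K / (?m + 1) * exponential_density ((?m + 1) * l) t"
        by (simp add: exponential_density_def exp_add[symmetric] field_simps)
      then show ?thesis
        using assms(1,4) by (simp add: ennreal_mult[symmetric] exponential_density_nonneg)
    qed
    then show ?thesis
      by (simp add: nn_integral_density)
  qed
  also have "\<dots> = ennreal (K / (?m + 1)) * emeasure (expo ((?m + 1) * l)) (space (expo ((?m + 1) * l)))"
    by (simp add: nn_integral_cmult emeasure_density)
  also have "\<dots> = ennreal (K / (?m + 1))"
    using prob_space.emeasure_space_1[OF prob_space_expo] assms(1) by simp
  finally show ?thesis
    using assms(4) by (simp add: P'.emeasure_eq_measure)
qed

lemma measure_expos_min:
  assumes "l > 0" "finite I" "i \<notin> I"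
  shows "measure (expos l (insert i I)) {x \<in> space (expos l (insert i I)). \<forall>j\<in>I. x i < x j}
    = 1 / (real (card I) + 1)"
proof -
  interpret P: prob_space "expos l I"
    using assms(1) by (rule prob_space_expos)
  have "measure (expos l I) {x \<in> space (expos l I). (\<forall>j\<in>I. t < x j) \<and> True} =
      1 * exp (- real (card I) * l * t)" if "t \<ge> 0" for t
    by (subst measure_expos_shift[OF assms(1) that assms(2)]) (simp_all add: P.prob_space)
  from measure_expos_min_first[OF assms zero_le_one _ this] show ?thesis
    by simp
qed

text \<open>
  For the minimum at \<open>t\<close>, the condition that some other point lies in \<open>(t, t + r]\<close> is the difference of
  the events that all other points exceed \<open>t\<close>, respectively \<open>t + r\<close>; lack of memory evaluates both.
\<close>

lemma measure_expos_min_small_gaps: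
  assumes "l > 0" "r \<ge> 0" "finite I" "I \<noteq> {}" "i \<notin> I"
  shows "measure (expos l (insert i I))
      {x \<in> space (expos l (insert i I)). (\<forall>j\<in>I. x i < x j) \<and> small_gaps (insert i I) r x} =
    measure (expos l I) {x \<in> space (expos l I). small_gaps I r x} *
      (1 - exp (- real (card I) * l * r)) / (real (card I) + 1)"
proof (rule measure_expos_min_first)
  interpret P: prob_space "expos l I"
    using assms(1) by (rule prob_space_expos)
  let ?p = "measure (expos l I) {x \<in> space (expos l I). small_gaps I r x}"
  let ?A = "\<lambda>t. {x \<in> space (expos l I). (\<forall>j\<in>I. t < x j) \<and> small_gaps I r x}"
  note [measurable] = pred_small_gaps[OF assms(3), of r]
  have A: "?A t \<in> P.events" for t
    using assms(3) by measurable
  have pA: "P.prob (?A t) = exp (- real (card I) * l * t) * ?p" if "t \<ge> 0" for t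
    using assms(1,3) that
    by (intro measure_expos_shift) (simp_all add: small_gaps_translate pred_small_gaps)
  fix t :: real assume t: "t \<ge> 0"
  have "small_gaps (insert i I) r (x(i := t)) \<longleftrightarrow> small_gaps I r x \<and> (\<exists>j\<in>I. x j \<le> t + r)"
    if "\<forall>j\<in>I. t < x j" for x
  proof -
    have upd: "\<And>j. j \<in> I \<Longrightarrow> (x(i := t)) j = x j"
      using assms(5) by auto
    have "small_gaps I r (x(i := t)) \<longleftrightarrow> small_gaps I r x"
      using upd by (rule small_gaps_cong)
    moreover have "(\<exists>j\<in>I. (x(i := t)) j \<le> (x(i := t)) i + r) \<longleftrightarrow> (\<exists>j\<in>I. x j \<le> t + r)"
      using assms(5) by (intro bex_cong refl) auto
    ultimately show ?thesis
      using small_gaps_insert_min[of I "x(i := t)" i r] assms(4) that upd by simp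
  qed
  then have "{x \<in> space (expos l I). (\<forall>j\<in>I. t < x j) \<and> small_gaps (insert i I) r (x(i := t))} =
      ?A t - ?A (t + r)"
    by (auto simp: not_less) (meson not_less)
  moreover have "?A (t + r) \<subseteq> ?A t"
    using assms(2) by force
  ultimately have "P.prob {x \<in> space (expos l I). (\<forall>j\<in>I. t < x j) \<and> small_gaps (insert i I) r (x(i := t))} =
      P.prob (?A t) - P.prob (?A (t + r))"
    using A by (simp only: P.finite_measure_Diff)
  also have "\<dots> = ?p * (1 - exp (- real (card I) * l * r)) * exp (- real (card I) * l * t)"
    using t assms(2) by (simp add: pA exp_add[symmetric] algebra_simps)
  finally show "P.prob {x \<in> space (expos l I). (\<forall>j\<in>I. t < x j) \<and> small_gaps (insert i I) r (x(i := t))} =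
      ?p * (1 - exp (- real (card I) * l * r)) * exp (- real (card I) * l * t)" .
qed (use assms in \<open>simp_all add: pred_small_gaps\<close>)

section \<open>The product formula\<close>

lemma measure_expos_small_gaps:
  assumes "l > 0" "r \<ge> 0" "card J = Suc m"
  shows "measure (expos l J) {x \<in> space (expos l J). small_gaps J r x} =
    (\<Prod>k = 1..m. 1 - exp (- real k * l * r))"
  using assms(3)
proof (induction m arbitrary: J)
  case 0
  then obtain i where "J = {i}"
    by (auto simp: card_1_singleton_iff)
  then have "small_gaps J r x" for x
    by (simp add: small_gaps_def)
  then show ?case
    using prob_space.prob_space[OF prob_space_expos[OF assms(1)]] by simp
next
  case (Suc m)
  interpret P: prob_space "expos l J"
    using assms(1) by (rule prob_space_expos)
  have J: "finite J"
    using Suc.prems by (simp add: card_ge_0_finite)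
  note [measurable] = pred_small_gaps[OF J, of r]
  let ?G = "{x \<in> space (expos l J). small_gaps J r x}"
  let ?S = "\<lambda>i. {x \<in> space (expos l J). \<forall>j\<in>J - {i}. x i < x j}"
  let ?p = "\<Prod>k = 1..m. 1 - exp (- real k * l * r)"
  have G: "?G \<in> P.events"
    by measurable
  have S: "?S i \<in> P.events" if "i \<in> J" for i
  proof -
    have "Measurable.pred (expos l J) (\<lambda>x. x i < x j)" if "j \<in> J - {i}" for j
      unfolding pred_def using \<open>i \<in> J\<close> that by (intro borel_measurable_less; measurable)
    then have "Measurable.pred (expos l J) (\<lambda>x. \<forall>j\<in>J - {i}. x i < x j)"
      using J by (intro pred_intros_finite) auto
    then show ?thesis
      by (simp only: pred_def)
  qed
  have disj: "disjoint_family_on ?S J"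
  proof (unfold disjoint_family_on_def, intro ballI impI equals0I)
    fix a b x assume "a \<in> J" "b \<in> J" "a \<noteq> b" "x \<in> ?S a \<inter> ?S b"
    then have "x a < x b" "x b < x a"
      by auto
    then show False
      by simp
  qed
  have card: "card (J - {i}) = Suc m" "insert i (J - {i}) = J" if "i \<in> J" for i
    using that Suc.prems by auto
  have "P.prob (?S i) = 1 / (real m + 2)" if "i \<in> J" for i
    using measure_expos_min[of l "J - {i}" i] card[OF that] J assms(1) by (simp add: add.commute)
  \<comment> \<open>Total mass one of the disjoint events \<open>?S i\<close> shows that ties for the minimum are negligible.\<close>
  then have "(\<Sum>i\<in>J. P.prob (?S i)) = 1"
    using Suc.prems by simp
  moreover have "P.prob (\<Union>i\<in>J. ?S i) = (\<Sum>i\<in>J. P.prob (?S i))"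
    using J S disj by (intro P.finite_measure_finite_Union) auto
  ultimately have "P.prob (\<Union>i\<in>J. ?S i) = 1"
    by simp
  then have "AE x in expos l J. x \<in> (\<Union>i\<in>J. ?S i)"
    by (rule P.AE_prob_1)
  moreover have "(\<Union>i\<in>J. ?S i \<inter> ?G) \<in> P.events"
    using J S G by (intro sets.finite_UN sets.Int)
  ultimately have "P.prob ?G = P.prob (\<Union>i\<in>J. ?S i \<inter> ?G)"
    using G by (intro P.finite_measure_eq_AE) auto
  also have "\<dots> = (\<Sum>i\<in>J. P.prob (?S i \<inter> ?G))"
    using J S G disj
    by (intro P.finite_measure_finite_Union) (auto simp: disjoint_family_on_def)
  also have "\<dots> = (\<Sum>i\<in>J. ?p * (1 - exp (- real (Suc m) * l * r)) / (real m + 2))"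
  proof (rule sum.cong[OF refl])
    fix i assume i: "i \<in> J"
    have "J - {i} \<noteq> {}"
      using card[OF i] by force
    then have "P.prob {x \<in> space (expos l J). (\<forall>j\<in>J - {i}. x i < x j) \<and> small_gaps J r x} =
        ?p * (1 - exp (- real (Suc m) * l * r)) / (real m + 2)"
      using measure_expos_min_small_gaps[of l r "J - {i}" i] Suc.IH[OF card(1)[OF i]]
        card[OF i] J assms(1,2)
      by (simp add: add.commute)
    moreover have "?S i \<inter> ?G = {x \<in> space (expos l J). (\<forall>j\<in>J - {i}. x i < x j) \<and> small_gaps J r x}"
      by blast
    ultimately show "P.prob (?S i \<inter> ?G) = ?p * (1 - exp (- real (Suc m) * l * r)) / (real m + 2)"
      by simp
  qed
  also have "\<dots> = ?p * (1 - exp (- real (Suc m) * l * r))"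
    using Suc.prems by (simp add: field_simps)
  finally show ?case
    by (simp add: prod.nat_ivl_Suc' mult.commute del: of_nat_Suc)
qed

theorem mainTheorem1:
  fixes M :: "'a measure" and X :: "nat \<Rightarrow> 'a \<Rightarrow> real" and lam r :: real and n :: nat
  assumes "prob_space M"
    and "lam > 0" and "r > 0" and "n \<ge> 1"
    and "prob_space.indep_vars M (\<lambda>_. borel) X {1..n}"
    and "\<And>i. i \<in> {1..n} \<Longrightarrow> distributed M lborel (X i) (exponential_density lam)"
  shows "measure M {\<omega> \<in> space M.
           Digraph_Component.connected (with_proj (geometric_graph n r (\<lambda>i. X i \<omega>)))}
         = (\<Prod>i = 1..n - 1. 1 - exp (- real i * lam * r))"
proof -
  interpret prob_space M by fact
  let ?I = "{1..n}"
  let ?Y = "\<lambda>\<omega>. \<lambda>i\<in>?I. X i \<omega>"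
  have X: "random_variable borel (X i)" if "i \<in> ?I" for i
    using distributed_measurable[OF assms(6)[OF that]] by simp
  have Y: "?Y \<in> M \<rightarrow>\<^sub>M (\<Pi>\<^sub>M i\<in>?I. borel)"
    using X by (intro measurable_restrict)
  have "distr M borel (X i) = expo lam" if "i \<in> ?I" for i
    using distributed_distr_eq_density[OF assms(6)[OF that]] by (simp cong: distr_cong)
  moreover have "distr M (\<Pi>\<^sub>M i\<in>?I. borel) ?Y = (\<Pi>\<^sub>M i\<in>?I. distr M borel (X i))"
    using assms(4,5) X by (subst indep_vars_iff_distr_eq_PiM'[symmetric]) auto
  ultimately have joint: "distr M (\<Pi>\<^sub>M i\<in>?I. borel) ?Y = expos lam ?I"
    using PiM_cong[of ?I ?I "\<lambda>i. distr M borel (X i)" "\<lambda>_. expo lam"] by simp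
  note [measurable] = pred_small_gaps[of ?I r, OF finite_atLeastAtMost]
  have "small_gaps ?I r (\<lambda>i. X i \<omega>) \<longleftrightarrow> small_gaps ?I r (?Y \<omega>)" for \<omega>
    by (rule small_gaps_cong) simp
  then have conn: "{\<omega> \<in> space M. Digraph_Component.connected (with_proj (geometric_graph n r (\<lambda>i. X i \<omega>)))} =
      ?Y -` {x \<in> space (\<Pi>\<^sub>M i\<in>?I. borel). small_gaps ?I r x} \<inter> space M"
    using measurable_space[OF Y] assms(3,4) by (auto simp: connected_geometric_graph_iff)
  have gaps: "{x \<in> space (\<Pi>\<^sub>M i\<in>?I. borel). small_gaps ?I r x} \<in> sets (\<Pi>\<^sub>M i\<in>?I. borel)"
    by measurable
  have "measure M {\<omega> \<in> space M.
        Digraph_Component.connected (with_proj (geometric_graph n r (\<lambda>i. X i \<omega>)))} =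
      measure (distr M (\<Pi>\<^sub>M i\<in>?I. borel) ?Y) {x \<in> space (\<Pi>\<^sub>M i\<in>?I. borel). small_gaps ?I r x}"
    unfolding conn by (rule measure_distr[OF Y gaps, symmetric])
  also have "\<dots> = measure (expos lam ?I) {x \<in> space (expos lam ?I). small_gaps ?I r x}"
    unfolding joint by (simp add: space_PiM)
  also have "\<dots> = (\<Prod>i = 1..n - 1. 1 - exp (- real i * lam * r))"
    using assms(2-4) by (intro measure_expos_small_gaps) simp_all
  finally show ?thesis .
qed

end
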